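(* Let $a,b\in\mathbb{Q}$ with $a\ne0$, and for $n\in\mathbb{N}$ let $f_n(x)=\frac1a\left((ax+b)^n-b\right)$. Then: (1) $f_n(x)$ is monic for all $n\in\mathbb{N}$ if and only if $a=1$. (2) $f_n(x)\in\mathbb{Z}[x]$ for all $n\in\mathbb{N}$ if and only if $a,b\in\mathbb{Z}$ and $a\mid b(b-1)$.
   Context: $\mathbb{N}$ denotes the positive integers. *)

theory Defs
  imports "HOL-Computational_Algebra.Polynomial"
begin

definition f_poly :: "rat \<Rightarrow> rat \<Rightarrow> nat \<Rightarrow> rat poly" where
  "f_poly a b n = smult (1 / a) ([:b, a:] ^ n - [:b:])"

(* Membership in the subring Z[x] of Q[x]. *)
definition in_Zx :: "rat poly \<Rightarrow> bool" where
  "in_Zx p \<longleftrightarrow> (\<forall>i. coeff p i \<in> \<int>)"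

end

theory Submission
  imports Defs
begin

text \<open>
  Both necessary conditions are read off \<open>f\<^sub>2 = a x\<^sup>2 + 2 b x + b (b - 1) / a\<close>: if it is integral, then so are
  \<open>2 b\<close> and \<open>b (b - 1)\<close>, which forces \<open>b\<close> to be an integer. Integrality of all \<open>f\<^sub>n\<close> follows from
  \<open>f\<^sub>1 = x\<close> and the recurrence \<open>f\<^sub>n\<^sub>+\<^sub>1 = (a x + b) f\<^sub>n + b x + b (b - 1) / a\<close>.
\<close>

lemma f_poly_1:
  assumes "a \<noteq> 0"
  shows "f_poly a b 1 = [:0, 1:]"
  using assms by (simp add: f_poly_def)

lemma f_poly_2:
  assumes "a \<noteq> 0"
  shows "f_poly a b 2 = [:b * (b - 1) / a, 2 * b, a:]"
  using assms by (simp add: f_poly_def power2_eq_square field_simps)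

text \<open>Write \<open>[:b, a:] ^ n\<close> as \<open>([:b, a:] ^ n - [:b:]) + [:b:]\<close>
  before multiplying by \<open>[:b, a:]\<close>: what is left beside the multiple of
  \<open>f_poly a b n\<close> is linear and does not depend on \<open>n\<close>.\<close>

lemma f_poly_Suc:
  assumes "a \<noteq> 0"
  shows "f_poly a b (Suc n) = [:b, a:] * f_poly a b n + [:b * (b - 1) / a, b:]"
proof -
  have "f_poly a b (Suc n) =
      [:b, a:] * f_poly a b n + smult (1 / a) ([:b, a:] * [:b:] - [:b:])"
    unfolding f_poly_def power_Suc mult_smult_right smult_add_right [symmetric]
    by (simp only: right_diff_distrib add_diff_eq diff_add_cancel)
  also have "smult (1 / a) ([:b, a:] * [:b:] - [:b:]) = [:b * (b - 1) / a, b:]"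
    using assms by (simp add: field_simps)
  finally show ?thesis .
qed

lemma lead_coeff_f_poly:
  assumes "n \<ge> 1"
  shows "lead_coeff (f_poly 1 b n) = 1"
proof -
  \<comment> \<open>The power has degree \<open>n\<close>, so \<open>n \<ge> 1\<close> keeps the
    constant away from the leading term; for \<open>n = 0\<close> the polynomial would be the
    constant \<open>1 - b\<close>.\<close>
  have "degree (- [:b:]) < degree ([:b, 1:] ^ n)"
    using assms by (simp add: degree_power_eq)
  then have "lead_coeff (- [:b:] + [:b, 1:] ^ n) = lead_coeff ([:b, 1:] ^ n)"
    by (rule lead_coeff_add_le)
  then have "lead_coeff ([:b, 1:] ^ n - [:b:]) = 1"
    by (simp only: uminus_add_conv_diff lead_coeff_power) simp
  then show ?thesis
    by (simp add: f_poly_def)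
qed

lemma in_Zx_add: "in_Zx p \<Longrightarrow> in_Zx q \<Longrightarrow> in_Zx (p + q)"
  by (simp add: in_Zx_def)

lemma in_Zx_mult: "in_Zx p \<Longrightarrow> in_Zx q \<Longrightarrow> in_Zx (p * q)"
  by (auto simp: in_Zx_def coeff_mult intro!: Ints_sum Ints_mult)

lemma in_Zx_pCons: "in_Zx (pCons c p) \<longleftrightarrow> c \<in> \<int> \<and> in_Zx p"
  by (auto simp: in_Zx_def coeff_pCons split: nat.splits)

lemma in_Zx_0: "in_Zx 0"
  by (simp add: in_Zx_def)

lemma in_Zx_f_poly:
  assumes "a \<noteq> 0" "a \<in> \<int>" "b \<in> \<int>" "b * (b - 1) / a \<in> \<int>" "n \<ge> 1"
  shows "in_Zx (f_poly a b n)"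
  using \<open>n \<ge> 1\<close>
\<comment> \<open>The induction has to start at 1, since the constant \<open>(1 - b) / a\<close>
  obtained for \<open>n = 0\<close> need not be an integer.\<close>
proof (induction n rule: nat_induct_at_least)
  case base
  show ?case
    unfolding f_poly_1 [OF \<open>a \<noteq> 0\<close>] by (simp add: in_Zx_pCons in_Zx_0)
next
  case (Suc n)
  show ?case
    unfolding f_poly_Suc [OF \<open>a \<noteq> 0\<close>]
    by (intro in_Zx_add in_Zx_mult Suc.IH) (simp_all add: in_Zx_pCons in_Zx_0 assms)
qed

text \<open>With \<open>t = 2 * b\<close>, the product \<open>t * (t - 2)\<close> equals
  \<open>4 * (b * (b - 1))\<close> and is even. Its factors have the same parity, so
  \<open>t\<close> is even; this rules out half-integers.\<close>

lemma rat_Ints_if_double_and_square_diff: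
  fixes b :: rat
  assumes "2 * b \<in> \<int>" "b * (b - 1) \<in> \<int>"
  shows "b \<in> \<int>"
proof -
  obtain t m :: int where t: "2 * b = of_int t" and m: "b * (b - 1) = of_int m"
    using assms by (metis Ints_cases)
  have "of_int (t * (t - 2)) = 2 * b * (2 * b - 2)"
    by (simp add: t)
  also have "\<dots> = 4 * (b * (b - 1))"
    by (simp add: algebra_simps)
  also have "\<dots> = of_int (4 * m)"
    by (simp add: m)
  finally have "t * (t - 2) = 4 * m"
    by (simp only: of_int_eq_iff)
  then have "even (t * (t - 2))"
    by simp
  then have "even t"
    by simp
  then obtain s where "t = 2 * s" ..
  with t have "b = of_int s"
    by simp
  then show ?thesis
    by simp
qed

text \<open>Links the divisibility condition to the integrality of \<open>b * (b - 1) / a\<close>,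
  in both directions of the second equivalence.\<close>

lemma of_int_divide_in_Ints_iff:
  fixes k m :: int
  assumes "k \<noteq> 0"
  shows "of_int m / of_int k \<in> (\<int> :: rat set) \<longleftrightarrow> k dvd m"
proof
  assume "of_int m / of_int k \<in> (\<int> :: rat set)"
  then obtain q where "of_int m / of_int k = (of_int q :: rat)"
    by (rule Ints_cases)
  then have "(of_int m :: rat) = of_int (k * q)"
    using assms by (simp add: field_simps)
  then show "k dvd m"
    by (simp only: of_int_eq_iff dvd_triv_left)
qed (use assms in \<open>auto\<close>)

theorem proposition3p1:
  fixes a b :: rat
  assumes "a \<noteq> 0"
  shows "((\<forall>n\<ge>1. lead_coeff (f_poly a b n) = 1) \<longleftrightarrow> a = 1) \<and>
         ((\<forall>n\<ge>1. in_Zx (f_poly a b n)) \<longleftrightarrow>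
            (\<exists>k l :: int. a = of_int k \<and> b = of_int l \<and> k dvd l * (l - 1)))"
proof (intro conjI iffI)
  assume "\<forall>n\<ge>1. lead_coeff (f_poly a b n) = 1"
  then have "lead_coeff (f_poly a b 2) = 1"
    by simp
  then show "a = 1"
    using assms by (simp add: f_poly_2)
next
  assume "a = 1"
  then show "\<forall>n\<ge>1. lead_coeff (f_poly a b n) = 1"
    by (simp add: lead_coeff_f_poly)
next
  assume "\<forall>n\<ge>1. in_Zx (f_poly a b n)"
  then have "in_Zx (f_poly a b 2)"
    by simp
  then have Z: "b * (b - 1) / a \<in> \<int>" "2 * b \<in> \<int>" "a \<in> \<int>"
    unfolding f_poly_2 [OF assms] by (simp_all add: in_Zx_pCons)
  \<comment> \<open>Multiplying the constant coefficient by the leading coefficient clears the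
    denominator.\<close>
  then have "b * (b - 1) / a * a \<in> \<int>"
    by (intro Ints_mult)
  then have "b * (b - 1) \<in> \<int>"
    using assms by simp
  with Z(2) have "b \<in> \<int>"
    by (rule rat_Ints_if_double_and_square_diff)
  with Z obtain k l where kl: "a = of_int k" "b = of_int l"
    by (metis Ints_cases)
  with Z have "of_int (l * (l - 1)) / of_int k \<in> (\<int> :: rat set)"
    by simp
  then have "k dvd l * (l - 1)"
    using assms kl by (subst (asm) of_int_divide_in_Ints_iff) auto
  with kl show "\<exists>k l :: int. a = of_int k \<and> b = of_int l \<and> k dvd l * (l - 1)"
    by blast
next
  assume "\<exists>k l :: int. a = of_int k \<and> b = of_int l \<and> k dvd l * (l - 1)"
  then obtain k l :: int
    where kl: "a = of_int k" "b = of_int l" and dvd: "k dvd l * (l - 1)"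
    by blast
  have "of_int (l * (l - 1)) / of_int k \<in> (\<int> :: rat set)"
    using assms kl dvd by (subst of_int_divide_in_Ints_iff) auto
  then have "b * (b - 1) / a \<in> \<int>"
    by (simp add: kl)
  then show "\<forall>n\<ge>1. in_Zx (f_poly a b n)"
    using assms kl by (simp add: in_Zx_f_poly)
qed

end
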